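(* Let $a_0,a_1,a_2,a_3\in\mathbb{C}$ with $a_0\neq 0$, let $f(x)=a_0x^3+3a_1x^2+3a_2x+a_3$, and put $$D_1=\begin{vmatrix} a_0 & a_1 \\ a_1 & a_2 \end{vmatrix},\quad D_2=\begin{vmatrix} a_0 & a_2 \\ a_1 & a_3 \end{vmatrix},\quad D_3=\begin{vmatrix} a_1 & a_2 \\ a_2 & a_3 \end{vmatrix}.$$ Suppose $D_1\neq 0$ and $D_2^2-4D_1D_3\neq 0$, and let $\lambda_{1,2}=\frac{D_2\pm\sqrt{D_2^2-4D_1D_3}}{2}$ be the two eigenvalues of $\begin{pmatrix} 0 & -D_3 \\ D_1 & D_2\end{pmatrix}$. Then $$f(x)=\frac{\lambda_2a_0-D_1a_1}{\lambda_2-\lambda_1}\Big(x+\frac{\lambda_1}{D_1}\Big)^3+\frac{\lambda_1a_0-D_1a_1}{\lambda_1-\lambda_2}\Big(x+\frac{\lambda_2}{D_1}\Big)^3,$$ and the complex roots of $f(x)=0$ are $$x_i=\frac{\gamma\omega^i\lambda_1-\lambda_2}{D_1(1-\gamma\omega^i)},\qquad i=0,1,2,$$ where $\gamma$ is a cube root of $\frac{\lambda_2a_0-D_1a_1}{\lambda_1a_0-D_1a_1}$ and $\omega=-\frac12+\frac{\sqrt3}{2}i$. *)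

theory Defs
  imports Complex_Main "Jordan_Normal_Form.Spectral_Radius"
begin

definition mat2 :: "'a \<Rightarrow> 'a \<Rightarrow> 'a \<Rightarrow> 'a \<Rightarrow> 'a mat" where
  "mat2 a b c d = mat_of_rows_list 2 [[a, b], [c, d]]"

definition omega :: complex where
  "omega = Complex (- 1 / 2) (sqrt 3 / 2)"

end

theory Submission
  imports Defs
begin

text \<open>
  With \<open>p\<^sub>i = \<lambda>\<^sub>i a\<^sub>0 - D\<^sub>1 a\<^sub>1\<close>, comparing coefficients gives
  \<open>(\<lambda>\<^sub>2 - \<lambda>\<^sub>1) D\<^sub>1\<^sup>3 f(x) = p\<^sub>2 (D\<^sub>1 x + \<lambda>\<^sub>1)\<^sup>3 - p\<^sub>1 (D\<^sub>1 x + \<lambda>\<^sub>2)\<^sup>3\<close>, and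
  \<open>p\<^sub>1 p\<^sub>2 = - D\<^sub>1\<^sup>3\<close> shows that neither \<open>p\<^sub>i\<close> vanishes. So \<open>f(x) = 0\<close> iff
  \<open>D\<^sub>1 x + \<lambda>\<^sub>2 = z (D\<^sub>1 x + \<lambda>\<^sub>1)\<close> for a cube root \<open>z\<close> of \<open>p\<^sub>2 / p\<^sub>1\<close>. There are three such
  \<open>z\<close>, all different from 1, and \<open>x\<close> is a Moebius function of \<open>z\<close>, hence the three roots are
  distinct and exhaust the degree.
\<close>

lemma mat2_carrier [simp]: "mat2 a b c d \<in> carrier_mat 2 2"
  by (simp add: mat2_def mat_of_rows_list_def numeral_2_eq_2)

text \<open>Laplace expansion along the first row; both minors are 1 by 1, so each determinant is
  the single entry left.\<close>

lemma det_mat2: "det (mat2 a b c d) = a * d - b * (c :: 'a :: comm_ring_1)"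
proof -
  have minor: "det (mat_delete (mat2 a b c d) 0 j) = mat_delete (mat2 a b c d) 0 j $$ (0, 0)"
    if "j < 2" for j
    using that by (intro det_single) (simp add: mat_delete_def mat2_def mat_of_rows_list_def)
  have "det (mat2 a b c d) = (\<Sum>j<2. mat2 a b c d $$ (0, j) * cofactor (mat2 a b c d) 0 j)"
    by (rule laplace_expansion_row) simp_all
  also have "\<dots> = a * d - b * c"
    by (simp add: numeral_2_eq_2 cofactor_def minor)
       (simp add: mat_delete_def mat2_def mat_of_rows_list_def)
  finally show ?thesis .
qed

lemma spectrum_mat2:
  "spectrum (mat2 a b c d) = {k :: 'a :: field. (a - k) * (d - k) - b * c = 0}"
proof -
  have "char_matrix (mat2 a b c d) k = mat2 (a - k) b c (d - k)" for k
    by (rule eq_matI)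
       (auto simp: char_matrix_def mat2_def mat_of_rows_list_def numeral_2_eq_2 less_Suc_eq)
  then show ?thesis
    by (auto simp: spectrum_def eigenvalue_det[OF mat2_carrier] det_mat2)
qed

text \<open>\<open>A\<close> already supplies \<open>degree p\<close> roots, and a nonzero
  polynomial has at most that many counted with multiplicity. So the inclusion of multisets is an
  equality and every root is simple.\<close>

lemma proots_eq_mset_set:
  fixes p :: "'a :: idom poly"
  assumes "p \<noteq> 0" "finite A" "card A = degree p" "\<And>x. x \<in> A \<Longrightarrow> poly p x = 0"
  shows "proots p = mset_set A"
proof -
  have "A \<subseteq> set_mset (proots p)"
    using assms by auto
  then have "mset_set A \<subseteq># proots p"
    by (meson assms(2) finite_set_mset mset_set_set_mset_msubset subset_imp_msubset_mset_set
        subset_mset.order_trans)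
  moreover have "size (proots p) \<le> size (mset_set A)"
    using size_proots_le[of p] assms by simp
  ultimately show ?thesis
    by (metis mset_subset_size subset_mset.le_imp_less_or_eq not_le)
qed

text \<open>Together these say that \<open>omega\<close> is a primitive cube root of unity; the
  inequalities make 1, \<open>omega\<close>, \<open>omega ^ 2\<close> pairwise distinct.\<close>

lemma omega_cube: "omega ^ 3 = 1"
  and omega_ne_1: "omega \<noteq> 1"
  and omega_square_ne_1: "omega ^ 2 \<noteq> 1"
  and omega_square_ne: "omega ^ 2 \<noteq> omega"
  by (auto simp: omega_def complex_eq_iff power2_eq_square power3_eq_cube field_simps)

theorem theorem3p4:
  fixes a\<^sub>0 a\<^sub>1 a\<^sub>2 a\<^sub>3 D\<^sub>1 D\<^sub>2 D\<^sub>3 s lam\<^sub>1 lam\<^sub>2 :: complex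
    and f :: "complex poly"
  assumes "a\<^sub>0 \<noteq> 0"
    and "f = [:a\<^sub>3, 3 * a\<^sub>2, 3 * a\<^sub>1, a\<^sub>0:]"
    and "D\<^sub>1 = det (mat2 a\<^sub>0 a\<^sub>1 a\<^sub>1 a\<^sub>2)"
    and "D\<^sub>2 = det (mat2 a\<^sub>0 a\<^sub>2 a\<^sub>1 a\<^sub>3)"
    and "D\<^sub>3 = det (mat2 a\<^sub>1 a\<^sub>2 a\<^sub>2 a\<^sub>3)"
    and "D\<^sub>1 \<noteq> 0"
    and "D\<^sub>2 ^ 2 - 4 * D\<^sub>1 * D\<^sub>3 \<noteq> 0"
    and "s ^ 2 = D\<^sub>2 ^ 2 - 4 * D\<^sub>1 * D\<^sub>3"
    and "lam\<^sub>1 = (D\<^sub>2 + s) / 2"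
    and "lam\<^sub>2 = (D\<^sub>2 - s) / 2"
  shows "lam\<^sub>1 \<noteq> lam\<^sub>2 \<and> spectrum (mat2 0 (- D\<^sub>3) D\<^sub>1 D\<^sub>2) = {lam\<^sub>1, lam\<^sub>2} \<and>
    (\<forall>x. poly f x =
           (lam\<^sub>2 * a\<^sub>0 - D\<^sub>1 * a\<^sub>1) / (lam\<^sub>2 - lam\<^sub>1) * (x + lam\<^sub>1 / D\<^sub>1) ^ 3
         + (lam\<^sub>1 * a\<^sub>0 - D\<^sub>1 * a\<^sub>1) / (lam\<^sub>1 - lam\<^sub>2) * (x + lam\<^sub>2 / D\<^sub>1) ^ 3) \<and>
    lam\<^sub>1 * a\<^sub>0 - D\<^sub>1 * a\<^sub>1 \<noteq> 0 \<and>
    (\<forall>\<gamma>. \<gamma> ^ 3 = (lam\<^sub>2 * a\<^sub>0 - D\<^sub>1 * a\<^sub>1) / (lam\<^sub>1 * a\<^sub>0 - D\<^sub>1 * a\<^sub>1) \<longrightarrow>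
           (\<forall>i\<in>{0, 1, 2}. D\<^sub>1 * (1 - \<gamma> * omega ^ i) \<noteq> 0) \<and>
           proots f =
             image_mset (\<lambda>i. (\<gamma> * omega ^ i * lam\<^sub>1 - lam\<^sub>2) / (D\<^sub>1 * (1 - \<gamma> * omega ^ i))) {#0, 1, 2#})"
proof -
  define p\<^sub>1 where "p\<^sub>1 = lam\<^sub>1 * a\<^sub>0 - D\<^sub>1 * a\<^sub>1"
  define p\<^sub>2 where "p\<^sub>2 = lam\<^sub>2 * a\<^sub>0 - D\<^sub>1 * a\<^sub>1"
  have D1: "D\<^sub>1 = a\<^sub>0 * a\<^sub>2 - a\<^sub>1 * a\<^sub>1"
    and D2: "D\<^sub>2 = a\<^sub>0 * a\<^sub>3 - a\<^sub>2 * a\<^sub>1"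
    and D3: "D\<^sub>3 = a\<^sub>1 * a\<^sub>3 - a\<^sub>2 * a\<^sub>2"
    using assms(3-5) by (simp_all add: det_mat2)
  \<comment> \<open>Vieta: through \<open>sum\<close> and \<open>prod\<close>, expressions symmetric
    in the two eigenvalues become polynomials in the coefficients of \<open>f\<close>, free of the
    square root \<open>s\<close>.\<close>
  have sum: "lam\<^sub>1 + lam\<^sub>2 = D\<^sub>2"
    by (simp add: assms(9,10) flip: add_divide_distrib)
  have prod: "lam\<^sub>1 * lam\<^sub>2 = D\<^sub>1 * D\<^sub>3"
  proof -
    have "4 * (lam\<^sub>1 * lam\<^sub>2) = (D\<^sub>2 + s) * (D\<^sub>2 - s)"
      unfolding assms(9,10) by simp
    also have "\<dots> = D\<^sub>2 ^ 2 - s ^ 2"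
      by Groebner_Basis.algebra
    finally show ?thesis
      using assms(8) by simp
  qed
  have "s \<noteq> 0"
    using assms(7,8) by auto
  then have ne: "lam\<^sub>1 \<noteq> lam\<^sub>2"
    using assms(9,10) by auto
  have "(0 - k) * (D\<^sub>2 - k) - (- D\<^sub>3) * D\<^sub>1 = (k - lam\<^sub>1) * (k - lam\<^sub>2)" for k
  proof -
    have "(0 - k) * (D\<^sub>2 - k) - (- D\<^sub>3) * D\<^sub>1 = k * k - D\<^sub>2 * k + D\<^sub>1 * D\<^sub>3"
      by (simp add: algebra_simps)
    also have "\<dots> = (k - lam\<^sub>1) * (k - lam\<^sub>2)"
      by (simp add: algebra_simps flip: sum prod)
    finally show ?thesis .
  qed
  then have spec: "spectrum (mat2 0 (- D\<^sub>3) D\<^sub>1 D\<^sub>2) = {lam\<^sub>1, lam\<^sub>2}"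
    unfolding spectrum_mat2 by auto
  have "p\<^sub>1 * p\<^sub>2 = a\<^sub>0 ^ 2 * (lam\<^sub>1 * lam\<^sub>2) - a\<^sub>0 * D\<^sub>1 * a\<^sub>1 * (lam\<^sub>1 + lam\<^sub>2) + D\<^sub>1 ^ 2 * a\<^sub>1 ^ 2"
    unfolding p\<^sub>1_def p\<^sub>2_def by Groebner_Basis.algebra
  also have "\<dots> = - (D\<^sub>1 ^ 3)"
    unfolding sum prod D1 D2 D3 by Groebner_Basis.algebra
  finally have "p\<^sub>1 * p\<^sub>2 = - (D\<^sub>1 ^ 3)" .
  then have p_ne: "p\<^sub>1 \<noteq> 0" "p\<^sub>2 \<noteq> 0"
    using assms(6) by auto
  \<comment> \<open>The division-free form serves twice: dividing it out gives the decomposition,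
    and the roots are read off from it directly.\<close>
  have cleared: "(lam\<^sub>2 - lam\<^sub>1) * D\<^sub>1 ^ 3 * poly f x =
      p\<^sub>2 * (D\<^sub>1 * x + lam\<^sub>1) ^ 3 - p\<^sub>1 * (D\<^sub>1 * x + lam\<^sub>2) ^ 3" for x
  proof -
    \<comment> \<open>The coefficient of \<open>(D\<^sub>1 * x) ^ (3 - k)\<close> is a binomial
      coefficient times \<open>p\<^sub>2 * lam\<^sub>1 ^ k - p\<^sub>1 * lam\<^sub>2 ^ k\<close>.
      This is antisymmetric under exchange of the eigenvalues, so
      \<open>lam\<^sub>2 - lam\<^sub>1\<close> splits off and the cofactor is symmetric; for
      \<open>k\<close> = 2, 3 it is evaluated by \<open>sum\<close> and \<open>prod\<close>.\<close>
    have c1: "p\<^sub>2 * lam\<^sub>1 - p\<^sub>1 * lam\<^sub>2 = (lam\<^sub>2 - lam\<^sub>1) * (D\<^sub>1 * a\<^sub>1)"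
      and c0: "p\<^sub>2 - p\<^sub>1 = (lam\<^sub>2 - lam\<^sub>1) * a\<^sub>0"
      unfolding p\<^sub>1_def p\<^sub>2_def by Groebner_Basis.algebra+
    have c2: "p\<^sub>2 * lam\<^sub>1 ^ 2 - p\<^sub>1 * lam\<^sub>2 ^ 2 = (lam\<^sub>2 - lam\<^sub>1) * (D\<^sub>1 ^ 2 * a\<^sub>2)"
    proof -
      have "p\<^sub>2 * lam\<^sub>1 ^ 2 - p\<^sub>1 * lam\<^sub>2 ^ 2 =
          (lam\<^sub>2 - lam\<^sub>1) * (D\<^sub>1 * a\<^sub>1 * (lam\<^sub>1 + lam\<^sub>2) - a\<^sub>0 * (lam\<^sub>1 * lam\<^sub>2))"
        unfolding p\<^sub>1_def p\<^sub>2_def by Groebner_Basis.algebra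
      also have "D\<^sub>1 * a\<^sub>1 * (lam\<^sub>1 + lam\<^sub>2) - a\<^sub>0 * (lam\<^sub>1 * lam\<^sub>2) = D\<^sub>1 ^ 2 * a\<^sub>2"
        unfolding sum prod D1 D2 D3 by Groebner_Basis.algebra
      finally show ?thesis .
    qed
    have c3: "p\<^sub>2 * lam\<^sub>1 ^ 3 - p\<^sub>1 * lam\<^sub>2 ^ 3 = (lam\<^sub>2 - lam\<^sub>1) * (D\<^sub>1 ^ 3 * a\<^sub>3)"
    proof -
      have "p\<^sub>2 * lam\<^sub>1 ^ 3 - p\<^sub>1 * lam\<^sub>2 ^ 3 =
          (lam\<^sub>2 - lam\<^sub>1) * (D\<^sub>1 * a\<^sub>1 * ((lam\<^sub>1 + lam\<^sub>2) ^ 2 - lam\<^sub>1 * lam\<^sub>2)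
            - a\<^sub>0 * (lam\<^sub>1 * lam\<^sub>2) * (lam\<^sub>1 + lam\<^sub>2))"
        unfolding p\<^sub>1_def p\<^sub>2_def by Groebner_Basis.algebra
      also have "D\<^sub>1 * a\<^sub>1 * ((lam\<^sub>1 + lam\<^sub>2) ^ 2 - lam\<^sub>1 * lam\<^sub>2)
            - a\<^sub>0 * (lam\<^sub>1 * lam\<^sub>2) * (lam\<^sub>1 + lam\<^sub>2) = D\<^sub>1 ^ 3 * a\<^sub>3"
        unfolding sum prod D1 D2 D3 by Groebner_Basis.algebra
      finally show ?thesis .
    qed
    have "p\<^sub>2 * (D\<^sub>1 * x + lam\<^sub>1) ^ 3 - p\<^sub>1 * (D\<^sub>1 * x + lam\<^sub>2) ^ 3 =
        (p\<^sub>2 - p\<^sub>1) * (D\<^sub>1 * x) ^ 3 + 3 * (p\<^sub>2 * lam\<^sub>1 - p\<^sub>1 * lam\<^sub>2) * (D\<^sub>1 * x) ^ 2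
        + 3 * (p\<^sub>2 * lam\<^sub>1 ^ 2 - p\<^sub>1 * lam\<^sub>2 ^ 2) * (D\<^sub>1 * x) + (p\<^sub>2 * lam\<^sub>1 ^ 3 - p\<^sub>1 * lam\<^sub>2 ^ 3)"
      by Groebner_Basis.algebra
    also have "\<dots> = (lam\<^sub>2 - lam\<^sub>1) * D\<^sub>1 ^ 3 * (a\<^sub>3 + x * (3 * a\<^sub>2 + x * (3 * a\<^sub>1 + x * a\<^sub>0)))"
      unfolding c0 c1 c2 c3 by Groebner_Basis.algebra
    finally show ?thesis
      using assms(2) by simp
  qed
  have decomp: "poly f x = p\<^sub>2 / (lam\<^sub>2 - lam\<^sub>1) * (x + lam\<^sub>1 / D\<^sub>1) ^ 3
      + p\<^sub>1 / (lam\<^sub>1 - lam\<^sub>2) * (x + lam\<^sub>2 / D\<^sub>1) ^ 3" for x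
  proof -
    have scale: "D\<^sub>1 * x + l = D\<^sub>1 * (x + l / D\<^sub>1)" for l
      using assms(6) by (simp add: field_simps)
    have "D\<^sub>1 ^ 3 * ((lam\<^sub>2 - lam\<^sub>1) * poly f x) =
        D\<^sub>1 ^ 3 * (p\<^sub>2 * (x + lam\<^sub>1 / D\<^sub>1) ^ 3 - p\<^sub>1 * (x + lam\<^sub>2 / D\<^sub>1) ^ 3)"
      using cleared[of x] unfolding scale power_mult_distrib by (simp add: algebra_simps)
    then have "(lam\<^sub>2 - lam\<^sub>1) * poly f x =
        p\<^sub>2 * (x + lam\<^sub>1 / D\<^sub>1) ^ 3 - p\<^sub>1 * (x + lam\<^sub>2 / D\<^sub>1) ^ 3"
      using assms(6) by simp
    then have "poly f x = (p\<^sub>2 * (x + lam\<^sub>1 / D\<^sub>1) ^ 3 - p\<^sub>1 * (x + lam\<^sub>2 / D\<^sub>1) ^ 3) / (lam\<^sub>2 - lam\<^sub>1)"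
      using ne by (simp add: nonzero_eq_divide_eq mult.commute)
    also have "\<dots> = p\<^sub>2 / (lam\<^sub>2 - lam\<^sub>1) * (x + lam\<^sub>1 / D\<^sub>1) ^ 3
        + p\<^sub>1 / (lam\<^sub>1 - lam\<^sub>2) * (x + lam\<^sub>2 / D\<^sub>1) ^ 3"
      \<comment> \<open>The minus sign moves into the denominator, turning
        \<open>lam\<^sub>2 - lam\<^sub>1\<close> into
        \<open>lam\<^sub>1 - lam\<^sub>2\<close>.\<close>
      using minus_divide_right[of "p\<^sub>1 * (x + lam\<^sub>2 / D\<^sub>1) ^ 3" "lam\<^sub>2 - lam\<^sub>1"]
      by (simp add: diff_divide_distrib)
    finally show ?thesis .
  qed
  have roots: "(\<forall>i\<in>{0, 1, 2}. D\<^sub>1 * (1 - \<gamma> * omega ^ i) \<noteq> 0) \<and>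
      proots f = image_mset (\<lambda>i. (\<gamma> * omega ^ i * lam\<^sub>1 - lam\<^sub>2) / (D\<^sub>1 * (1 - \<gamma> * omega ^ i))) {#0, 1, 2#}"
    if \<gamma>: "\<gamma> ^ 3 = p\<^sub>2 / p\<^sub>1" for \<gamma>
  proof -
    define g where "g i = \<gamma> * omega ^ i" for i :: nat
    \<comment> \<open>\<open>r z\<close> is the solution \<open>x\<close> of \<open>D\<^sub>1 * x +
      lam\<^sub>2 = z * (D\<^sub>1 * x + lam\<^sub>1)\<close> for
      \<open>z \<noteq> 1\<close>.\<close>
    define r where "r z = (z * lam\<^sub>1 - lam\<^sub>2) / (D\<^sub>1 * (1 - z))" for z
    have g3: "p\<^sub>1 * g i ^ 3 = p\<^sub>2" for i
    proof -
      have "(omega ^ i) ^ 3 = (omega ^ 3) ^ i"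
        by (simp only: power_mult[symmetric] mult.commute)
      then show ?thesis
        using \<gamma> p_ne(1) by (simp add: g_def power_mult_distrib omega_cube)
    qed
    have g1: "g i \<noteq> 1" for i
    proof
      assume "g i = 1"
      then have "p\<^sub>1 = p\<^sub>2"
        using g3[of i] by simp
      \<comment> \<open>The difference \<open>p\<^sub>1 - p\<^sub>2\<close> is
        \<open>(lam\<^sub>1 - lam\<^sub>2) * a\<^sub>0\<close>, which is nonzero.\<close>
      then show False
        using ne assms(1) by (simp add: p\<^sub>1_def p\<^sub>2_def)
    qed
    have "\<gamma> \<noteq> 0"
      using \<gamma> p_ne by auto
    then have g_distinct: "g 0 \<noteq> g 1" "g 0 \<noteq> g 2" "g 1 \<noteq> g 2"
      using omega_ne_1 omega_square_ne_1 omega_square_ne by (auto simp: g_def)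
    have r_inj: "x = y" if "r x = r y" "x \<noteq> 1" "y \<noteq> 1" for x y
    proof -
      have "(x * lam\<^sub>1 - lam\<^sub>2) * (D\<^sub>1 * (1 - y)) = (y * lam\<^sub>1 - lam\<^sub>2) * (D\<^sub>1 * (1 - x))"
        using that assms(6) by (simp add: r_def frac_eq_eq)
      \<comment> \<open>The factor in front of \<open>x - y\<close> is, up to sign, the determinant
        of the Moebius map \<open>r\<close>; it is nonzero because the eigenvalues differ.\<close>
      then have "D\<^sub>1 * (lam\<^sub>1 - lam\<^sub>2) * (x - y) = 0"
        by Groebner_Basis.algebra
      then show ?thesis
        using assms(6) ne by simp
    qed
    have root: "poly f (r (g i)) = 0" for i
    proof -
      have r1: "D\<^sub>1 * r (g i) * (1 - g i) = g i * lam\<^sub>1 - lam\<^sub>2"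
        using g1[of i] assms(6) by (simp add: r_def field_simps)
      have "D\<^sub>1 * r (g i) + lam\<^sub>2 = g i * (D\<^sub>1 * r (g i) + lam\<^sub>1)"
        using r1 by Groebner_Basis.algebra
      \<comment> \<open>Cubing the relation produces \<open>g i ^ 3\<close>, which \<open>g3\<close>
        trades for the ratio of \<open>p\<^sub>2\<close> to \<open>p\<^sub>1\<close>; the two cubes
        in \<open>cleared\<close> then cancel.\<close>
      then have "p\<^sub>1 * (D\<^sub>1 * r (g i) + lam\<^sub>2) ^ 3 = p\<^sub>2 * (D\<^sub>1 * r (g i) + lam\<^sub>1) ^ 3"
        using g3[of i] by (simp add: power_mult_distrib flip: mult.assoc)
      then show ?thesis
        using cleared[of "r (g i)"] ne assms(6) by simp
    qed
    have r_distinct: "r (g 0) \<noteq> r (g 1)" "r (g 0) \<noteq> r (g 2)" "r (g 1) \<noteq> r (g 2)"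
      using r_inj g1 g_distinct by metis+
    have "proots f = mset_set {r (g 0), r (g 1), r (g 2)}"
      using assms(1,2) root r_distinct by (intro proots_eq_mset_set) auto
    also have "\<dots> = image_mset (\<lambda>i. r (g i)) {#0, 1, 2#}"
      using r_distinct by simp
    finally show ?thesis
      using g1 assms(6) by (simp add: r_def g_def)
  qed
  show ?thesis
    using ne spec decomp p_ne(1) roots unfolding p\<^sub>1_def p\<^sub>2_def by blast
qed

end
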